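(* For every integer $L\ge 1$, $$\frac{1}{1+(-1)^{L}\hbar^{-2L}e_{2}^{\circ_{\hbar}L}X^{2L}}=\exp_{\ast_{\hbar}}\left(2\sum_{k\ge 1}\frac{(-1)^{k-1}}{(2k)!}\hbar^{-2k}\phi_{2k}\sum_{m=1}^{L}\left(2\arcsin\frac{e^{m\pi i/L}X}{2}\right)^{2k}\right)$$ as formal power series in $X$. In particular, $$\frac{1}{1-\hbar^{-2}e_{2}X^{2}}=\exp_{\ast_{\hbar}}\left(2\sum_{k\ge1}\frac{(-1)^{k-1}}{(2k)!}\hbar^{-2k}\phi_{2k}\,\bigl(2\arcsin(X/2)\bigr)^{2k}\right).$$
   Context: Notation. $\mathcal{C}=\mathbb{Q}[\hbar,\hbar^{-1}]$. $\widehat{\mathfrak{H}^{1}}=\mathcal{C}\langle e_{1},g_{1},g_{2},g_{3},\ldots\rangle$ is the non-commutative polynomial ring over $\mathcal{C}$ (concatenation product), and $e_{k}=g_{k}+\hbar g_{k-1}$ for $k\ge2$. $\mathcal{A}=\{e_{1}-g_{1}\}\sqcup\{g_{k}\mid k\ge1\}$ freely generates it, and $\mathfrak{z}$ is the free $\mathcal{C}$-module spanned by $\mathcal{A}$. The symmetric (associative) $\mathcal{C}$-bilinear map $\circ_{\hbar}:\mathfrak{z}\times\mathfrak{z}\to\mathfrak{z}$ is given by $(e_{1}-g_{1})\circ_{\hbar}(e_{1}-g_{1})=\hbar(e_{1}-g_{1})$, $(e_{1}-g_{1})\circ_{\hbar}g_{k}=\hbar g_{k}$, $g_{k}\circ_{\hbar}g_{l}=g_{k+l}$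 $(k,l\ge1)$. Write $u^{\circ_{\hbar}1}=u$, $u^{\circ_{\hbar}n}=u^{\circ_{\hbar}(n-1)}\circ_{\hbar}u$. The harmonic product $\ast_{\hbar}$ on $\widehat{\mathfrak{H}^{1}}$ is the (commutative, associative) $\mathcal{C}$-bilinear product determined by $w\ast_{\hbar}1=1\ast_{\hbar}w=w$ and $(wu)\ast_{\hbar}(w'v)=(w\ast_{\hbar}w'v)u+(wu\ast_{\hbar}w')v+(w\ast_{\hbar}w')(u\circ_{\hbar}v)$ for $w,w'\in\widehat{\mathfrak{H}^{1}}$, $u,v\in\mathcal{A}$. All these operations are extended to power series in the central variable $X$ coefficientwise, and, where needed, from $\mathcal{C}$ to $\mathbb{C}[\hbar,\hbar^{-1}]$. For $f(X)$ in $X\widehat{\mathfrak{H}^{1}}[[X]]$, $\exp_{\ast_{\hbar}}(f)=1+\sum_{n\ge1}\frac{1}{n!}f^{\ast_{\hbar}n}$; $\frac{1}{1+f(X)}=\sum_{n\ge0}(-f(X))^{n}$ is the inverse with respect to concatenation. For $k\ge1$, $\phi_{k}=\sum_{j=1}^{k}(j-1)!\,{k\brace j}\,\hbar^{k-j}g_{j}$, where ${k\brace j}$ is the Stirling number of the second kind. $\arcsin$ denotes its Taylor series at $0$. *)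

theory Defs
  imports
    "HOL-Complex_Analysis.Complex_Analysis"
    "HOL-Library.Poly_Mapping"
    "HOL-Combinatorics.Stirling"
begin

text \<open>
  Laurent polynomials in \<open>\<hbar>\<close> are the monoid algebra of the additive group of integers. All
  coefficients are taken in \<open>\<complex>[\<hbar>, \<hbar>\<^sup>-\<^sup>1]\<close>, since roots of unity occur in the identities.
\<close>

type_synonym laurent = "int \<Rightarrow>\<^sub>0 complex"

definition hbar_pow :: "int \<Rightarrow> laurent" where
  "hbar_pow n = Poly_Mapping.single n 1"

text \<open>
  The free generators: \<open>EG\<close> is \<open>e\<^sub>1 - g\<^sub>1\<close>, and \<open>G n\<close> is \<open>g\<^bsub>n+1\<^esub>\<close> (index shifted by one, so
  that there is no letter \<open>g\<^sub>0\<close>).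
\<close>

datatype letter = EG | G nat

type_synonym zmod = "letter \<Rightarrow>\<^sub>0 laurent"

text \<open>
  The free monoid of words; with it the multiplication of \<^typ>\<open>letter list \<Rightarrow>\<^sub>0 laurent\<close> is the
  concatenation product.
\<close>

instantiation list :: (type) monoid_add
begin

definition zero_list_def: "0 = []"

definition plus_list_def: "xs + ys = xs @ ys"

instance
  by standard (simp_all add: zero_list_def plus_list_def)

end

type_synonym H1 = "letter list \<Rightarrow>\<^sub>0 laurent"

definition cmul :: "laurent \<Rightarrow> ('a \<Rightarrow>\<^sub>0 laurent) \<Rightarrow> ('a \<Rightarrow>\<^sub>0 laurent)" where
  "cmul c x = Poly_Mapping.map ((*) c) x"

definition linear_ext :: "('a \<Rightarrow> ('c \<Rightarrow>\<^sub>0 laurent)) \<Rightarrow> ('a \<Rightarrow>\<^sub>0 laurent) \<Rightarrow> ('c \<Rightarrow>\<^sub>0 laurent)" where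
  "linear_ext f x = (\<Sum>a\<in>Poly_Mapping.keys x. cmul (Poly_Mapping.lookup x a) (f a))"

definition bilinear_ext ::
  "('a \<Rightarrow> 'b \<Rightarrow> ('c \<Rightarrow>\<^sub>0 laurent)) \<Rightarrow> ('a \<Rightarrow>\<^sub>0 laurent) \<Rightarrow> ('b \<Rightarrow>\<^sub>0 laurent) \<Rightarrow> ('c \<Rightarrow>\<^sub>0 laurent)" where
  "bilinear_ext f x y = linear_ext (\<lambda>a. linear_ext (f a) y) x"

definition z_to_H1 :: "zmod \<Rightarrow> H1" where
  "z_to_H1 = linear_ext (\<lambda>a. Poly_Mapping.single [a] 1)"

text \<open>The elements \<open>g\<^sub>k\<close> and \<open>e\<^sub>k\<close>, meaningful for \<open>k \<ge> 1\<close> only.\<close>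

definition gen_g :: "nat \<Rightarrow> zmod" where
  "gen_g k = Poly_Mapping.single (G (k - 1)) 1"

definition gen_e :: "nat \<Rightarrow> zmod" where
  "gen_e k = (if k = 1 then Poly_Mapping.single EG 1 + gen_g 1
              else gen_g k + cmul (hbar_pow 1) (gen_g (k - 1)))"

fun circ_letter :: "letter \<Rightarrow> letter \<Rightarrow> zmod" where
  "circ_letter EG EG = cmul (hbar_pow 1) (Poly_Mapping.single EG 1)"
| "circ_letter EG (G k) = cmul (hbar_pow 1) (Poly_Mapping.single (G k) 1)"
| "circ_letter (G k) EG = cmul (hbar_pow 1) (Poly_Mapping.single (G k) 1)"
| "circ_letter (G k) (G l) = Poly_Mapping.single (G (Suc (k + l))) 1"

definition circ :: "zmod \<Rightarrow> zmod \<Rightarrow> zmod" where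
  "circ = bilinear_ext circ_letter"

text \<open>The iterated product of \<open>n\<close> factors, meaningful for \<open>n \<ge> 1\<close> only.\<close>

definition circ_power :: "zmod \<Rightarrow> nat \<Rightarrow> zmod" where
  "circ_power u n = ((\<lambda>v. circ v u) ^^ (n - 1)) u"

text \<open>The recursion for the harmonic product strips letters from the right.\<close>

function harm_word :: "letter list \<Rightarrow> letter list \<Rightarrow> H1" where
  "harm_word w w' =
    (if w = [] then Poly_Mapping.single w' 1
     else if w' = [] then Poly_Mapping.single w 1
     else harm_word (butlast w) w' * Poly_Mapping.single [last w] 1
        + harm_word w (butlast w') * Poly_Mapping.single [last w'] 1
        + harm_word (butlast w) (butlast w') * z_to_H1 (circ_letter (last w) (last w')))"
  by pat_completeness auto
termination
  by (relation "Wellfounded.measure (\<lambda>(w, w'). length w + length w')")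
    (auto simp: length_greater_0_conv[symmetric] simp del: length_greater_0_conv)

declare harm_word.simps [simp del]

definition harm :: "H1 \<Rightarrow> H1 \<Rightarrow> H1" where
  "harm = bilinear_ext harm_word"

definition harm_fps :: "H1 fps \<Rightarrow> H1 fps \<Rightarrow> H1 fps" where
  "harm_fps f g = Abs_fps (\<lambda>n. \<Sum>i=0..n. harm (fps_nth f i) (fps_nth g (n - i)))"

definition harm_fps_power :: "H1 fps \<Rightarrow> nat \<Rightarrow> H1 fps" where
  "harm_fps_power f n = ((\<lambda>h. harm_fps h f) ^^ n) 1"

definition complex_to_H1_fps :: "complex fps \<Rightarrow> H1 fps" where
  "complex_to_H1_fps S =
     Abs_fps (\<lambda>n. Poly_Mapping.single [] (Poly_Mapping.single 0 (fps_nth S n)))"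

text \<open>
  Infinite sums of power series are taken in the \<open>X\<close>-adic topology of \<^typ>\<open>'a fps\<close>. A locally
  finite family converges there, and its sum is computed coefficientwise:
\<close>

lemma fps_has_sum_locally_finite:
  fixes F :: "'i \<Rightarrow> 'a :: ab_group_add fps"
  assumes "\<And>n. finite {k\<in>K. fps_nth (F k) n \<noteq> 0}"
  shows "(F has_sum Abs_fps (\<lambda>n. \<Sum>k\<in>{k\<in>K. fps_nth (F k) n \<noteq> 0}. fps_nth (F k) n)) K"
  unfolding has_sum_def
proof (rule tendsto_fpsI)
  fix n
  let ?A = "{k\<in>K. fps_nth (F k) n \<noteq> 0}"
  have "fps_nth (sum F B) n = fps_nth (Abs_fps (\<lambda>n. \<Sum>k\<in>{k\<in>K. fps_nth (F k) n \<noteq> 0}. fps_nth (F k) n)) n"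
    if "finite B" "?A \<subseteq> B" "B \<subseteq> K" for B
    using that by (auto simp: fps_sum_nth intro!: sum.mono_neutral_right)
  then show "\<forall>\<^sub>F B in finite_subsets_at_top K. fps_nth (sum F B) n =
      fps_nth (Abs_fps (\<lambda>n. \<Sum>k\<in>{k\<in>K. fps_nth (F k) n \<noteq> 0}. fps_nth (F k) n)) n"
    unfolding eventually_finite_subsets_at_top using assms[of n] by blast
qed

text \<open>
  The following two operations are meaningful for \<open>f\<close> with zero constant term, where
  the families are locally finite.
\<close>

definition inv_one_plus :: "H1 fps \<Rightarrow> H1 fps" where
  "inv_one_plus f = (\<Sum>\<^sub>\<infinity>n. (- f) ^ n)"

definition exp_harm :: "H1 fps \<Rightarrow> H1 fps" where
  "exp_harm f =
     1 + (\<Sum>\<^sub>\<infinity>n\<in>{1..}. complex_to_H1_fps (fps_const (1 / fact n)) * harm_fps_power f n)"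

definition phi :: "nat \<Rightarrow> zmod" where
  "phi k = (\<Sum>j=1..k. cmul (of_nat (fact (j - 1) * Stirling k j) * hbar_pow (int k - int j)) (gen_g j))"

definition arcsin_fps :: "complex fps" where
  "arcsin_fps = fps_expansion Arcsin 0"

text \<open>The series \<open>2 arcsin (c X / 2)\<close>.\<close>

definition two_arcsin_half :: "complex \<Rightarrow> complex fps" where
  "two_arcsin_half c = 2 * fps_compose arcsin_fps (fps_const (c / 2) * fps_X)"

end

theory Submission
  imports Defs
begin

text \<open>
  The module \<open>z\<close> is unital under \<open>\<circ>\<close> with unit \<open>\<hbar>\<^sup>-\<^sup>1 (e\<^sub>1 - g\<^sub>1)\<close>, and \<open>s\<^sup>j \<mapsto> \<hbar>\<^sup>-\<^sup>j g\<^sub>j\<close>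
  is a homomorphism from \<open>\<complex>[s]\<close> to it, which sends \<open>s + s\<^sup>2\<close> to \<open>\<hbar>\<^sup>-\<^sup>2 e\<^sub>2\<close> and the polynomial
  with coefficients \<open>(j - 1)! S(k, j)\<close> to \<open>\<hbar>\<^sup>-\<^sup>k \<phi>\<^sub>k\<close>.

  For \<open>f\<close> in the image of \<open>X \<complex>[s][[X]]\<close>, put \<open>p\<^sub>n = f\<^sup>*\<^sup>n / n!\<close> and \<open>f\<^sub>j = f\<^sup>\<circ>\<^sup>j / j!\<close>. The
  recursion of the harmonic product, in the case where the right factor is a single letter,
  yields \<open>p\<^sub>n = p\<^sub>0 f\<^sub>n + \<dots> + p\<^bsub>n-1\<^esub> f\<^sub>1\<close> by induction; summing over \<open>n\<close>, the harmonic
  exponential of \<open>f\<close> is the concatenation inverse of \<open>1 - h\<close>, where \<open>1 + h\<close> is the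
  \<open>\<circ>\<close>-exponential of \<open>f\<close>. It remains to exponentiate in \<open>\<complex>[s][[X]]\<close>, which may be done at each
  complex value of \<open>s\<close>. The exponential generating function of the polynomials above is
  \<open>- log (1 - s (e\<^sup>y - 1))\<close>. With \<open>y = \<plusminus>i\<theta>\<close>, \<open>\<theta> = 2 arcsin (c X / 2)\<close>, and the two signs added,
  its exponential becomes \<open>1 + (s + s\<^sup>2) (2 - 2 cos \<theta>) = 1 + (s + s\<^sup>2) c\<^sup>2 X\<^sup>2\<close>; the product over the
  roots of unity \<open>c\<^sup>2\<close> is \<open>1 - (- (s + s\<^sup>2) X\<^sup>2)\<^sup>L\<close>.
\<close>

subsection \<open>The harmonic product with a letter\<close>

lemma lookup_cmul [simp]: "Poly_Mapping.lookup (cmul c x) k = c * Poly_Mapping.lookup x k"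
  unfolding cmul_def by transfer (auto simp: when_def)

lemma cmul_0_left [simp]: "cmul 0 x = 0"
  by (intro poly_mapping_eqI) simp

lemma cmul_0_right [simp]: "cmul c 0 = 0"
  by (intro poly_mapping_eqI) simp

lemma cmul_add_left: "cmul (c + d) x = cmul c x + cmul d x"
  by (intro poly_mapping_eqI) (simp add: lookup_add algebra_simps)

lemma cmul_add_right: "cmul c (x + y) = cmul c x + cmul c y"
  by (intro poly_mapping_eqI) (simp add: lookup_add algebra_simps)

lemma cmul_cmul: "cmul c (cmul d x) = cmul (c * d) x"
  by (intro poly_mapping_eqI) (simp add: algebra_simps)

lemma cmul_one [simp]: "cmul 1 x = x"
  by (intro poly_mapping_eqI) simp

lemma cmul_single: "cmul c (Poly_Mapping.single k d) = Poly_Mapping.single k (c * d)"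
  by (intro poly_mapping_eqI) (simp add: lookup_single when_def)

lemma single_conv_cmul: "Poly_Mapping.single k c = cmul c (Poly_Mapping.single k 1)"
  by (simp add: cmul_single)

lemma cmul_sum: "cmul c (sum f A) = (\<Sum>a\<in>A. cmul c (f a))"
  by (induction A rule: infinite_finite_induct) (auto simp: cmul_add_right)

text \<open>Singles generate additively, so multilinear identities need checking only on words and
  letters with coefficients.\<close>

lemma poly_mapping_single_induct [case_names zero single add]:
  assumes "P 0" "\<And>k c. P (Poly_Mapping.single k c)" "\<And>x y. P x \<Longrightarrow> P y \<Longrightarrow> P (x + y)"
  shows "P (x :: 'a \<Rightarrow>\<^sub>0 'b :: comm_monoid_add)"
proof (induction x rule: update_induct)
  case (update f k v)
  then have "Poly_Mapping.update k v f = f + Poly_Mapping.single k v"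
    by (intro poly_mapping_eqI)
      (auto simp: lookup_add lookup_update lookup_single when_def in_keys_iff)
  with update assms show ?case by auto
qed (use assms in auto)

lemma linear_ext_superset:
  assumes "finite A" "Poly_Mapping.keys x \<subseteq> A"
  shows "linear_ext f x = (\<Sum>a\<in>A. cmul (Poly_Mapping.lookup x a) (f a))"
  unfolding linear_ext_def using assms
  by (intro sum.mono_neutral_left) (auto simp: in_keys_iff)

lemma linear_ext_0 [simp]: "linear_ext f 0 = 0"
  by (simp add: linear_ext_def)

lemma linear_ext_single [simp]: "linear_ext f (Poly_Mapping.single a c) = cmul c (f a)"
  by (subst linear_ext_superset[of "{a}"]) auto

lemma linear_ext_add: "linear_ext f (x + y) = linear_ext f x + linear_ext f y"
proof -
  let ?A = "Poly_Mapping.keys x \<union> Poly_Mapping.keys y"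
  have "Poly_Mapping.keys (x + y) \<subseteq> ?A" by (rule keys_add)
  then show ?thesis
    by (simp add: linear_ext_superset[of ?A] lookup_add cmul_add_left sum.distrib)
qed

lemma linear_ext_cmul: "linear_ext f (cmul c x) = cmul c (linear_ext f x)"
  by (induction x rule: poly_mapping_single_induct)
    (simp_all add: cmul_single linear_ext_add cmul_add_right cmul_cmul)

lemma linear_ext_add_fun: "linear_ext (\<lambda>a. f a + g a) x = linear_ext f x + linear_ext g x"
  by (simp add: linear_ext_def cmul_add_right sum.distrib)

lemma linear_ext_cmul_fun: "linear_ext (\<lambda>a. cmul c (f a)) x = cmul c (linear_ext f x)"
  by (simp add: linear_ext_def cmul_sum cmul_cmul mult.commute)

lemma linear_ext_0_fun [simp]: "linear_ext (\<lambda>a. 0) x = 0"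
  by (simp add: linear_ext_def)

lemma bilinear_ext_simps:
  "bilinear_ext f 0 y = 0" "bilinear_ext f x 0 = 0"
  "bilinear_ext f (x + x') y = bilinear_ext f x y + bilinear_ext f x' y"
  "bilinear_ext f x (y + y') = bilinear_ext f x y + bilinear_ext f x y'"
  "bilinear_ext f (cmul c x) y = cmul c (bilinear_ext f x y)"
  "bilinear_ext f x (cmul c y) = cmul c (bilinear_ext f x y)"
  "bilinear_ext f (Poly_Mapping.single a d) (Poly_Mapping.single b e) = cmul (d * e) (f a b)"
  by (simp_all add: bilinear_ext_def linear_ext_add linear_ext_add_fun linear_ext_cmul
      linear_ext_cmul_fun cmul_cmul mult.commute)

lemmas harm_simps = bilinear_ext_simps[of harm_word, folded harm_def]
lemmas circ_simps = bilinear_ext_simps[of circ_letter, folded circ_def]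

lemma z_to_H1_simps:
  "z_to_H1 0 = 0" "z_to_H1 (u + v) = z_to_H1 u + z_to_H1 v"
  "z_to_H1 (cmul c u) = cmul c (z_to_H1 u)"
  "z_to_H1 (Poly_Mapping.single a c) = Poly_Mapping.single [a] c"
  by (simp_all add: z_to_H1_def linear_ext_add linear_ext_cmul cmul_single)

lemma cmul_eq_mult: "cmul c x = Poly_Mapping.single [] c * (x :: H1)"
  unfolding cmul_def mult_map_scale_conv_mult zero_list_def ..

lemma mult_cmul_left: "cmul c x * y = cmul c (x * y :: H1)"
  by (simp add: cmul_eq_mult mult.assoc)

lemma single_Nil_commute: "Poly_Mapping.single [] c * x = x * (Poly_Mapping.single [] c :: H1)"
  by (induction x rule: poly_mapping_single_induct)
    (simp_all add: mult_single plus_list_def algebra_simps)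

lemma mult_cmul_right: "x * cmul c y = cmul c (x * y :: H1)"
  by (metis cmul_eq_mult mult.assoc single_Nil_commute)

text \<open>Two of the three recursive calls strip the right factor down to the empty word and
  collapse to plain words; only \<open>harm_word w [b]\<close> remains.\<close>

lemma harm_word_snoc_single:
  "harm_word (w @ [a]) [b] =
     Poly_Mapping.single (w @ [a, b]) 1 + harm_word w [b] * Poly_Mapping.single [a] 1
     + Poly_Mapping.single w 1 * z_to_H1 (circ_letter a b)"
  by (subst harm_word.simps) (simp add: harm_word.simps[of _ "[]"] harm_word.simps[of "[]"] mult_single plus_list_def add_ac)

text \<open>Every term is additive in \<open>W\<close>, \<open>u\<close> and \<open>v\<close>, so
  nested inductions reduce the claim to the recursion for a word against one letter.\<close>

lemma harm_mult_letter:
  "harm (W * z_to_H1 u) (z_to_H1 v) =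
     W * z_to_H1 u * z_to_H1 v + harm W (z_to_H1 v) * z_to_H1 u + W * z_to_H1 (circ u v)"
proof (induction v rule: poly_mapping_single_induct)
  case (single b e)
  show ?case
  proof (induction u rule: poly_mapping_single_induct)
    case (single a d)
    show ?case
    proof (induction W rule: poly_mapping_single_induct)
      case (single w c)
      have main: "harm (Poly_Mapping.single w 1 * Poly_Mapping.single [a] 1) (Poly_Mapping.single [b] 1) =
          Poly_Mapping.single w 1 * Poly_Mapping.single [a] 1 * Poly_Mapping.single [b] 1
          + harm (Poly_Mapping.single w 1) (Poly_Mapping.single [b] 1) * Poly_Mapping.single [a] 1
          + Poly_Mapping.single w 1 * z_to_H1 (circ_letter a b)"
        by (simp add: harm_simps harm_word_snoc_single mult_single plus_list_def)
      show ?case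
        by (simp only: single_conv_cmul[of w c] single_conv_cmul[of "[a]" d]
            single_conv_cmul[of "[b]" e] z_to_H1_simps circ_simps harm_simps
            mult_cmul_left mult_cmul_right main)
          (simp add: cmul_cmul cmul_add_right mult_ac)
    qed (simp_all add: harm_simps z_to_H1_simps algebra_simps)
  qed (simp_all add: harm_simps circ_simps z_to_H1_simps algebra_simps)
qed (simp_all add: harm_simps circ_simps z_to_H1_simps algebra_simps)

lemma one_H1: "(1 :: H1) = Poly_Mapping.single [] 1"
  by (metis single_one zero_list_def)

lemma harm_1_left: "harm 1 x = x"
  by (induction x rule: poly_mapping_single_induct)
    (simp_all add: harm_simps one_H1 harm_word.simps[of "[]"] cmul_single)

subsection \<open>Polynomials as elements of the letter module\<close>

text \<open>The powers of \<open>\<hbar>\<close> absorb those in \<open>circ_letter\<close>. The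
  constant term carries the exponent -1, not 0, because the unit is the letter \<open>EG\<close>
  divided by \<open>\<hbar>\<close>.\<close>

lift_definition zpoly :: "complex poly \<Rightarrow> zmod" is
  "\<lambda>p l. Poly_Mapping.single (case l of EG \<Rightarrow> - 1 | G n \<Rightarrow> - int (Suc n))
     (coeff p (case l of EG \<Rightarrow> 0 | G n \<Rightarrow> Suc n))"
proof -
  fix p :: "complex poly"
  have "{l. Poly_Mapping.single (case l of EG \<Rightarrow> - 1 | G n \<Rightarrow> - int (Suc n))
     (coeff p (case l of EG \<Rightarrow> 0 | G n \<Rightarrow> Suc n)) \<noteq> 0} \<subseteq> insert EG (G ` {..degree p})"
    (is "?A \<subseteq> _")
  proof
    fix l assume l: "l \<in> ?A"
    show "l \<in> insert EG (G ` {..degree p})"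
    proof (cases l)
      case (G n)
      with l have "coeff p (Suc n) \<noteq> 0" by auto
      then have "Suc n \<le> degree p" by (rule le_degree)
      with G show ?thesis by simp
    qed simp
  qed
  then show "finite ?A" by (rule finite_subset) simp
qed

lemma zpoly_0 [simp]: "zpoly 0 = 0"
  by (intro poly_mapping_eqI, transfer) simp

lemma zpoly_add: "zpoly (p + q) = zpoly p + zpoly q"
  by (intro poly_mapping_eqI) (simp add: lookup_add zpoly.rep_eq single_add)

lemma zpoly_smult: "zpoly (smult c p) = cmul (Poly_Mapping.single 0 c) (zpoly p)"
  by (intro poly_mapping_eqI) (simp add: zpoly.rep_eq mult_single)

lemma zpoly_monom_0: "zpoly (monom c 0) = Poly_Mapping.single EG (Poly_Mapping.single (- 1) c)"
  by (intro poly_mapping_eqI) (auto simp: zpoly.rep_eq lookup_single when_def split: letter.split)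

lemma zpoly_monom_Suc:
  "zpoly (monom c (Suc n)) = Poly_Mapping.single (G n) (Poly_Mapping.single (- int (Suc n)) c)"
  by (intro poly_mapping_eqI) (auto simp: zpoly.rep_eq lookup_single when_def split: letter.split)

lemma poly_monom_induct [case_names monom add]:
  assumes "\<And>c n. P (monom c n)" "\<And>p q. P p \<Longrightarrow> P q \<Longrightarrow> P (p + q)"
  shows "P (p :: 'a :: comm_monoid_add poly)"
proof -
  have "P (\<Sum>i\<in>A. monom (coeff p i) i)" if "finite A" for A
    using that assms(1)[of 0 0] by induction (auto intro: assms)
  from this[of "{..degree p}"] show ?thesis by (simp add: poly_as_sum_of_monoms)
qed

text \<open>On monomials, the exponents being zero or positive gives four cases, which match the
  four clauses of \<open>circ_letter\<close>.\<close>

lemma zpoly_mult: "zpoly (p * q) = circ (zpoly p) (zpoly q)"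
proof (induction p rule: poly_monom_induct)
  case (monom c i)
  show ?case
  proof (induction q rule: poly_monom_induct)
    case (monom d j)
    show ?case
      by (cases i; cases j)
        (simp_all add: zpoly_monom_0 zpoly_monom_Suc mult_monom circ_simps cmul_single
          hbar_pow_def mult_single)
  qed (simp add: zpoly_add circ_simps algebra_simps)
qed (simp add: zpoly_add circ_simps algebra_simps)


section \<open>Polynomials and power series over them inside the algebra of words\<close>

definition H1poly :: "complex poly \<Rightarrow> H1" where
  "H1poly p = z_to_H1 (zpoly p)"

lemma H1poly_0 [simp]: "H1poly 0 = 0"
  by (simp add: H1poly_def z_to_H1_simps)

lemma H1poly_add: "H1poly (p + q) = H1poly p + H1poly q"
  by (simp add: H1poly_def z_to_H1_simps zpoly_add)

lemma H1poly_uminus: "H1poly (- p) = - H1poly p"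
  using H1poly_add[of p "- p"] by (simp add: eq_neg_iff_add_eq_0 add.commute)

lemma H1poly_sum: "H1poly (sum f A) = (\<Sum>a\<in>A. H1poly (f a))"
  by (induction A rule: infinite_finite_induct) (auto simp: H1poly_add)

lemma H1poly_smult:
  "H1poly (smult c p) = Poly_Mapping.single [] (Poly_Mapping.single 0 c) * H1poly p"
  by (simp add: H1poly_def z_to_H1_simps zpoly_smult cmul_eq_mult)

lemma harm_mult_H1poly:
  "harm (W * H1poly p) (H1poly q) =
     W * H1poly p * H1poly q + harm W (H1poly q) * H1poly p + W * H1poly (p * q)"
  by (simp add: H1poly_def harm_mult_letter zpoly_mult)

definition H1poly_fps :: "complex poly fps \<Rightarrow> H1 fps" where
  "H1poly_fps P = Abs_fps (\<lambda>n. H1poly (fps_nth P n))"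

lemma H1poly_fps_nth [simp]: "fps_nth (H1poly_fps P) n = H1poly (fps_nth P n)"
  by (simp add: H1poly_fps_def)

lemma H1poly_fps_add: "H1poly_fps (P + Q) = H1poly_fps P + H1poly_fps Q"
  by (simp add: fps_eq_iff H1poly_add)

lemma H1poly_fps_of_nat_mult: "H1poly_fps (of_nat n * P) = of_nat n * H1poly_fps P"
  by (induction n) (simp_all add: H1poly_fps_add algebra_simps fps_eq_iff)

lemma harm_fps_nth: "fps_nth (harm_fps f g) n = (\<Sum>i=0..n. harm (fps_nth f i) (fps_nth g (n - i)))"
  by (simp add: harm_fps_def)

lemma harm_fps_add_left: "harm_fps (f + f') g = harm_fps f g + harm_fps f' g"
  by (simp add: fps_eq_iff harm_fps_nth harm_simps sum.distrib)

lemma harm_fps_0_left: "harm_fps 0 g = 0"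
  by (simp add: fps_eq_iff harm_fps_nth harm_simps)

lemma harm_fps_sum_left: "harm_fps (sum f A) g = (\<Sum>a\<in>A. harm_fps (f a) g)"
  by (induction A rule: infinite_finite_induct) (auto simp: harm_fps_add_left harm_fps_0_left)

lemma harm_fps_1_left: "harm_fps 1 g = g"
proof (rule fps_ext)
  fix n
  have "fps_nth (harm_fps 1 g) n = (\<Sum>i=0..n. if i = 0 then fps_nth g n else 0)"
    unfolding harm_fps_nth by (intro sum.cong) (auto simp: harm_1_left harm_simps)
  then show "fps_nth (harm_fps 1 g) n = fps_nth g n" by simp
qed

lemma harm_sum_left: "harm (sum f A) y = (\<Sum>a\<in>A. harm (f a) y)"
  by (induction A rule: infinite_finite_induct) (auto simp: harm_simps)

lemma complex_to_H1_fps_0 [simp]: "complex_to_H1_fps 0 = 0"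
  by (simp add: complex_to_H1_fps_def fps_eq_iff)

lemma complex_to_H1_fps_const:
  "complex_to_H1_fps (fps_const c) = fps_const (Poly_Mapping.single [] (Poly_Mapping.single 0 c))"
  by (auto simp: complex_to_H1_fps_def fps_eq_iff)

lemma harm_fps_const_left:
  "harm_fps (complex_to_H1_fps (fps_const c) * W) V = complex_to_H1_fps (fps_const c) * harm_fps W V"
  by (simp add: complex_to_H1_fps_const fps_eq_iff harm_fps_nth cmul_eq_mult[symmetric] harm_simps cmul_sum)

text \<open>Coefficientwise this is \<open>harm_mult_H1poly\<close>, summed over all ways to write
  \<open>n\<close> as a sum of three indices.\<close>

lemma harm_fps_mult_H1poly_fps:
  "harm_fps (W * H1poly_fps P) (H1poly_fps Q) =
     W * H1poly_fps P * H1poly_fps Q + harm_fps W (H1poly_fps Q) * H1poly_fps P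
     + W * H1poly_fps (P * Q)"
proof (rule fps_ext)
  fix n
  let ?w = "fps_nth W" and ?p = "\<lambda>i. H1poly (fps_nth P i)" and ?q = "\<lambda>i. H1poly (fps_nth Q i)"
  have "fps_nth (harm_fps (W * H1poly_fps P) (H1poly_fps Q)) n =
      (\<Sum>j=0..n. \<Sum>i=0..j. ?w i * ?p (j - i) * ?q (n - j))
      + (\<Sum>j=0..n. \<Sum>i=0..j. harm (?w i) (?q (n - j)) * ?p (j - i))
      + (\<Sum>j=0..n. \<Sum>i=0..j. ?w i * H1poly (fps_nth P (j - i) * fps_nth Q (n - j)))"
    by (simp add: harm_fps_nth fps_mult_nth harm_sum_left harm_mult_H1poly sum.distrib)
  also have "(\<Sum>j=0..n. \<Sum>i=0..j. ?w i * ?p (j - i) * ?q (n - j)) =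
      fps_nth (W * H1poly_fps P * H1poly_fps Q) n"
    by (simp add: fps_mult_nth sum_distrib_right)
  also have "(\<Sum>j=0..n. \<Sum>i=0..j. ?w i * H1poly (fps_nth P (j - i) * fps_nth Q (n - j))) =
      fps_nth (W * H1poly_fps (P * Q)) n"
    by (subst fps_mult_assoc_lemma[where f = "\<lambda>i j k. ?w i * H1poly (fps_nth P j * fps_nth Q k)"])
      (simp add: fps_mult_nth sum_distrib_left H1poly_sum)
  \<comment> \<open>Here \<open>Q\<close> is paired with \<open>W\<close> first and \<open>P\<close>
    comes last, so the triple sum is rebracketed, its inner sum reversed, and rebracketed
    back.\<close>
  also have "(\<Sum>j=0..n. \<Sum>i=0..j. harm (?w i) (?q (n - j)) * ?p (j - i)) =
      (\<Sum>j=0..n. \<Sum>i=0..n - j. harm (?w j) (?q (n - j - i)) * ?p i)"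
    by (rule fps_mult_assoc_lemma[where f = "\<lambda>i j k. harm (?w i) (?q k) * ?p j"])
  also have "\<dots> = (\<Sum>j=0..n. \<Sum>i=0..n - j. harm (?w j) (?q i) * ?p (n - j - i))"
  proof (rule sum.cong[OF refl])
    fix j
    show "(\<Sum>i=0..n - j. harm (?w j) (?q (n - j - i)) * ?p i) =
        (\<Sum>i=0..n - j. harm (?w j) (?q i) * ?p (n - j - i))"
      by (rule sum.reindex_bij_witness[of _ "\<lambda>i. n - j - i" "\<lambda>i. n - j - i"])
        (auto simp del: diff_diff_left)
  qed
  also have "\<dots> = (\<Sum>j=0..n. \<Sum>i=0..j. harm (?w i) (?q (j - i)) * ?p (n - j))"
    by (rule fps_mult_assoc_lemma[where f = "\<lambda>i j k. harm (?w i) (?q j) * ?p k", symmetric])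
  also have "\<dots> = fps_nth (harm_fps W (H1poly_fps Q) * H1poly_fps P) n"
    by (simp add: fps_mult_nth harm_fps_nth sum_distrib_right)
  finally show "fps_nth (harm_fps (W * H1poly_fps P) (H1poly_fps Q)) n =
      fps_nth (W * H1poly_fps P * H1poly_fps Q + harm_fps W (H1poly_fps Q) * H1poly_fps P
        + W * H1poly_fps (P * Q)) n"
    by simp
qed

subsection \<open>The harmonic exponential\<close>

text \<open>Here \<open>D\<close> models the harmonic product with f, \<open>p n\<close> is f^n / n!
  for the harmonic product, and \<open>e j\<close> is f^j / j! for \<circ>. Applying
  \<open>D\<close> to the formula for \<open>p (Suc n)\<close> produces each
  \<open>p j * e (n + 2 - j)\<close> with weight \<open>j\<close> from \<open>D_p\<close> and weight
  \<open>n + 2 - j\<close> from the \<circ>-term. The weights add up to \<open>n + 2\<close>, which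
  cancels.\<close>

lemma exp_recursion:
  fixes p e :: "nat \<Rightarrow> 'a :: ring_1" and D :: "'a \<Rightarrow> 'a"
  assumes D_sum: "\<And>f n. D (\<Sum>j\<le>n. f j) = (\<Sum>j\<le>(n::nat). D (f j))"
    and D_mult: "\<And>x j. D (x * e (Suc j)) =
      x * e (Suc j) * e 1 + D x * e (Suc j) + x * (of_nat (Suc (Suc j)) * e (Suc (Suc j)))"
    and D_p: "\<And>n. D (p n) = of_nat (Suc n) * p (Suc n)"
    and p_0: "p 0 = 1" and D_1: "D 1 = e 1"
    and cancel: "\<And>n x y. of_nat (Suc n) * x = of_nat (Suc n) * (y :: 'a) \<Longrightarrow> x = y"
  shows "p (Suc n) = (\<Sum>j\<le>n. p j * e (Suc n - j))"
proof (induction n)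
  case 0
  show ?case using D_p[of 0] by (simp add: p_0 D_1)
next
  case (Suc n)
  let ?g = "\<lambda>j. p j * e (Suc (Suc n) - j)"
  have comm: "x * (of_nat k * y) = of_nat k * (x * y)" for x y :: 'a and k
    by (metis mult.assoc mult_of_nat_commute)
  have "of_nat (Suc (Suc n)) * p (Suc (Suc n)) = (\<Sum>j\<le>n. D (p j * e (Suc (n - j))))"
    by (simp only: D_p[symmetric] Suc D_sum, intro sum.cong) (auto simp: Suc_diff_le)
  also have "\<dots> = (\<Sum>j\<le>n. p j * e (Suc (n - j))) * e 1
      + (\<Sum>j\<le>n. of_nat (Suc j) * ?g (Suc j)) + (\<Sum>j\<le>n. of_nat (Suc (Suc n) - j) * ?g j)"
    unfolding D_mult D_p sum.distrib sum_distrib_right comm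
    by (intro arg_cong2[where f = "(+)"] sum.cong refl)
      (simp_all only: Suc_diff_le atMost_iff mult.assoc diff_Suc_Suc le_SucI)
  \<comment> \<open>By the induction hypothesis the concatenation terms sum to
    \<open>p (Suc n) * e 1\<close>. This is the summand \<open>j = Suc n\<close>, of weight 1, that
    the last sum lacks.\<close>
  also have "(\<Sum>j\<le>n. p j * e (Suc (n - j))) * e 1 = ?g (Suc n)"
    unfolding Suc by (simp add: Suc_diff_le)
  also have "(\<Sum>j\<le>n. of_nat (Suc j) * ?g (Suc j)) = (\<Sum>j\<le>Suc n. of_nat j * ?g j)"
    by (simp add: sum.atMost_Suc_shift del: sum.atMost_Suc)
  also have "?g (Suc n) + (\<Sum>j\<le>Suc n. of_nat j * ?g j) + (\<Sum>j\<le>n. of_nat (Suc (Suc n) - j) * ?g j)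
      = (\<Sum>j\<le>Suc n. of_nat j * ?g j) + (\<Sum>j\<le>Suc n. of_nat (Suc (Suc n) - j) * ?g j)"
    by (simp add: algebra_simps)
  also have "\<dots> = (\<Sum>j\<le>Suc n. of_nat (Suc (Suc n)) * ?g j)"
    unfolding sum.distrib[symmetric] distrib_right[symmetric] of_nat_add[symmetric]
    by (intro sum.cong) auto
  also have "\<dots> = of_nat (Suc (Suc n)) * (\<Sum>j\<le>Suc n. ?g j)"
    by (simp only: sum_distrib_left)
  finally show ?case by (rule cancel)
qed

text \<open>Summing the convolution recursion over all \<open>n\<close> turns it into a product. The
  order conditions make every coefficient a finite sum.\<close>

lemma sum_fps_recursion:
  fixes p e :: "nat \<Rightarrow> 'a :: ring_1 fps"
  assumes p: "\<And>n N. N < n \<Longrightarrow> fps_nth (p n) N = 0"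
    and e: "\<And>n N. N < n \<Longrightarrow> fps_nth (e n) N = 0"
    and rec: "\<And>n. p n = (if n = 0 then 1 else 0) + (\<Sum>i\<le>n. p i * e (n - i))"
  defines "P \<equiv> Abs_fps (\<lambda>N. \<Sum>n\<le>N. fps_nth (p n) N)"
    and "E \<equiv> Abs_fps (\<lambda>N. \<Sum>n\<le>N. fps_nth (e n) N)"
  shows "P = 1 + P * E"
proof (rule fps_ext)
  fix N
  \<comment> \<open>Truncation at the index of the coefficient may be replaced by truncation at the
    common bound \<open>N\<close>.\<close>
  have ext: "(\<Sum>n\<le>i. fps_nth (f n) i) = (\<Sum>n\<le>N. fps_nth (f n) i)"
    if "\<And>n N. N < n \<Longrightarrow> fps_nth (f n) N = 0" "i \<le> N" for i and f :: "nat \<Rightarrow> 'a fps"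
    by (rule sum.mono_neutral_left) (use that in auto)
  \<comment> \<open>The order of \<open>p i * e j\<close> is at least \<open>i + j\<close>, so the
    sum over a square of indices equals the sum over a triangle.\<close>
  have z: "fps_nth (p i * e j) N = 0" if "N < i + j" for i j
    unfolding fps_mult_nth
  proof (rule sum.neutral, clarsimp)
    fix k assume "k \<le> N"
    with that have "k < i \<or> N - k < j" by auto
    then show "fps_nth (p i) k * fps_nth (e j) (N - k) = 0" by (auto simp: p e)
  qed
  have "fps_nth (P * E) N = (\<Sum>k=0..N. (\<Sum>i\<le>N. fps_nth (p i) k) * (\<Sum>j\<le>N. fps_nth (e j) (N - k)))"
    unfolding fps_mult_nth P_def E_def fps_nth_Abs_fps
    by (intro sum.cong refl arg_cong2[where f = "(*)"] ext p e) auto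
  also have "\<dots> = (\<Sum>i\<le>N. \<Sum>j\<le>N. fps_nth (p i * e j) N)"
    unfolding fps_mult_nth sum_product
    by (subst sum.swap) (rule sum.cong[OF refl sum.swap])
  also have "\<dots> = (\<Sum>(i, j)\<in>{..N} \<times> {..N}. fps_nth (p i * e j) N)"
    by (simp add: sum.cartesian_product)
  also have "\<dots> = (\<Sum>(i, j)\<in>{(i, j). i + j \<le> N}. fps_nth (p i * e j) N)"
    by (rule sum.mono_neutral_right) (auto intro: z)
  also have "\<dots> = (\<Sum>k\<le>N. \<Sum>i\<le>k. fps_nth (p i * e (k - i)) N)"
    by (rule sum.triangle_reindex_eq)
  also have "fps_nth 1 N + \<dots> = (\<Sum>k\<le>N. fps_nth (p k) N)"
  proof -
    have "(\<Sum>k\<le>N. fps_nth (p k) N) =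
        (\<Sum>k\<le>N. (if k = 0 then fps_nth 1 N else 0) + (\<Sum>i\<le>k. fps_nth (p i * e (k - i)) N))"
      by (intro sum.cong refl, subst rec) (simp add: fps_sum_nth)
    then show ?thesis by (simp add: sum.distrib)
  qed
  finally show "fps_nth P N = fps_nth (1 + P * E) N"
    by (simp add: P_def)
qed

text \<open>In coefficient \<open>N\<close> of \<open>P * E\<close> the factor
  \<open>fps_nth P N\<close> meets the zero constant term of \<open>E\<close>, so the equation
  determines the coefficients one after another.\<close>

lemma fps_right_fixpoint_unique:
  fixes P Q E :: "'a :: ring_1 fps"
  assumes "P = 1 + P * E" "Q = 1 + Q * E" "fps_nth E 0 = 0"
  shows "P = Q"
proof (rule fps_ext)
  fix N
  show "fps_nth P N = fps_nth Q N"
  proof (induction N rule: less_induct)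
    case (less N)
    have "fps_nth P i * fps_nth E (N - i) = fps_nth Q i * fps_nth E (N - i)" if "i \<le> N" for i
      using that less[of i] assms(3) by (cases "i = N") auto
    then have "fps_nth (P * E) N = fps_nth (Q * E) N"
      by (simp add: fps_mult_nth)
    then show ?case
      by (subst assms(1), subst assms(2)) simp
  qed
qed

lemma infsum_fps_nth:
  fixes F :: "nat \<Rightarrow> 'a :: ab_group_add fps"
  assumes "\<And>k n. n < k \<Longrightarrow> fps_nth (F k) n = 0"
  shows "fps_nth (\<Sum>\<^sub>\<infinity>k\<in>{a..}. F k) n = (\<Sum>k=a..n. fps_nth (F k) n)"
proof -
  have sub: "{k\<in>{a..}. fps_nth (F k) n \<noteq> 0} \<subseteq> {a..n}" for n
    using assms by (auto simp: not_less[symmetric])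
  then have "(F has_sum Abs_fps (\<lambda>n. \<Sum>k\<in>{k\<in>{a..}. fps_nth (F k) n \<noteq> 0}. fps_nth (F k) n)) {a..}"
    by (intro fps_has_sum_locally_finite) (meson finite_atLeastAtMost finite_subset)
  then have "fps_nth (\<Sum>\<^sub>\<infinity>k\<in>{a..}. F k) n = (\<Sum>k\<in>{k\<in>{a..}. fps_nth (F k) n \<noteq> 0}. fps_nth (F k) n)"
    by (simp add: infsumI)
  also have "\<dots> = (\<Sum>k=a..n. fps_nth (F k) n)"
    by (rule sum.mono_neutral_left) (use sub in auto)
  finally show ?thesis .
qed

lemma fps_power_nth_eq_0:
  fixes E :: "'a :: ring_1 fps"
  assumes "fps_nth E 0 = 0" "N < n"
  shows "fps_nth (E ^ n) N = 0"
  using assms(2)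
proof (induction n arbitrary: N)
  case (Suc n)
  have "fps_nth E i * fps_nth (E ^ n) (N - i) = 0" if "i \<le> N" for i
    using Suc that assms(1) by (cases "i = 0") auto
  then show ?case by (simp add: fps_mult_nth)
qed auto

text \<open>The geometric series obeys the same convolution recursion, with \<open>E\<close> at
  index 1 and 0 at all other indices.\<close>

lemma inv_one_plus_fixpoint:
  assumes "fps_nth E 0 = 0"
  shows "inv_one_plus (- E) = 1 + inv_one_plus (- E) * E"
proof -
  let ?e = "\<lambda>n. if n = 1 then E else 0"
  have "E ^ n = (if n = 0 then 1 else 0) + (\<Sum>i\<le>n. E ^ i * ?e (n - i))" for n
  proof (cases n)
    case (Suc m)
    have "(\<Sum>i\<le>n. E ^ i * ?e (n - i)) = (\<Sum>i\<le>n. if i = m then E ^ m * E else 0)"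
      using Suc by (intro sum.cong) auto
    then show ?thesis using Suc by (simp add: power_commutes)
  qed simp
  note rec = this
  have "Abs_fps (\<lambda>N. \<Sum>n\<le>N. fps_nth (E ^ n) N) = 1 + Abs_fps (\<lambda>N. \<Sum>n\<le>N. fps_nth (E ^ n) N) *
      Abs_fps (\<lambda>N. \<Sum>n\<le>N. fps_nth (?e n) N)"
    by (rule sum_fps_recursion[OF _ _ rec]) (use assms in \<open>auto simp: fps_power_nth_eq_0\<close>)
  moreover have "Abs_fps (\<lambda>N. \<Sum>n\<le>N. fps_nth (?e n) N) = E"
  proof (rule fps_ext)
    fix N
    have "(\<Sum>n\<le>N. fps_nth (?e n) N) = (\<Sum>n\<le>N. if n = 1 then fps_nth E N else 0)"
      by (intro sum.cong) auto
    then show "fps_nth (Abs_fps (\<lambda>N. \<Sum>n\<le>N. fps_nth (?e n) N)) N = fps_nth E N"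
      using assms by (cases N) auto
  qed
  moreover have "inv_one_plus (- E) = Abs_fps (\<lambda>N. \<Sum>n\<le>N. fps_nth (E ^ n) N)"
    using infsum_fps_nth[of "\<lambda>n. E ^ n" 0] assms
    by (auto simp: inv_one_plus_def fps_eq_iff fps_power_nth_eq_0 atLeast0AtMost atLeast_0)
  ultimately show ?thesis by simp
qed

lemma harm_fps_power_Suc: "harm_fps_power f (Suc n) = harm_fps (harm_fps_power f n) f"
  by (simp add: harm_fps_power_def)

lemma harm_fps_power_nth_eq_0:
  assumes "fps_nth f 0 = 0" "N < n"
  shows "fps_nth (harm_fps_power f n) N = 0"
  using assms(2)
proof (induction n arbitrary: N)
  case (Suc n)
  have "harm (fps_nth (harm_fps_power f n) i) (fps_nth f (N - i)) = 0" if "i \<le> N" for i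
    using Suc that assms(1) by (cases "i = N") (auto simp: harm_simps)
  then show ?case by (simp add: harm_fps_power_Suc harm_fps_nth)
qed auto

lemma of_nat_mult_complex_to_H1_fps:
  "of_nat n * complex_to_H1_fps (fps_const c) = complex_to_H1_fps (fps_const (of_nat n * c))"
proof (induction n)
  case (Suc n)
  have "complex_to_H1_fps (fps_const (a + b)) = complex_to_H1_fps (fps_const a) + complex_to_H1_fps (fps_const b)"
    for a b by (simp add: complex_to_H1_fps_const single_add)
  with Suc show ?case by (simp add: algebra_simps)
qed (simp add: complex_to_H1_fps_const)

text \<open>\<open>E\<close> is the ordinary exponential of \<open>F\<close> minus 1. Both sides
  solve \<open>P = 1 + P * H1poly_fps E\<close>, which has only one solution.\<close>

lemma exp_harm_H1poly_fps:
  assumes F: "fps_nth F 0 = 0"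
  defines "E \<equiv> Abs_fps (\<lambda>N. \<Sum>j=1..N. smult (1 / fact j) (fps_nth (F ^ j) N))"
  shows "exp_harm (H1poly_fps F) = inv_one_plus (- H1poly_fps E)"
proof -
  let ?f = "H1poly_fps F"
  define c where "c = (\<lambda>x. complex_to_H1_fps (fps_const x))"
  define p where "p n = c (1 / fact n) * harm_fps_power ?f n" for n
  \<comment> \<open>Polynomials do not form a field, so reciprocal factorials enter as constants,
    and \<open>k_Suc\<close> takes the place of division.\<close>
  define k where "k j = fps_const [:1 / fact j :: complex:]" for j
  have k_Suc: "k j = of_nat (Suc j) * k (Suc j)" for j
  proof -
    have "1 / fact j = of_nat (Suc j) * (1 / fact (Suc j) :: complex)"
      by (simp del: of_nat_Suc)
    then show ?thesis
      unfolding k_def fps_of_nat[symmetric] fps_const_mult of_nat_poly by simp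
  qed
  \<comment> \<open>The value 0 at \<open>j = 0\<close>, instead of 1, removes the term
    \<open>p n * e 0\<close> from the convolution and the constant 1 from the exponential.\<close>
  define e where "e j = (if j = 0 then 0 else H1poly_fps (k j * F ^ j))" for j
  have e_0: "e 0 = 0"
    by (simp add: e_def)
  have e_Suc: "e (Suc j) = H1poly_fps (k (Suc j) * F ^ Suc j)" for j
    by (simp add: e_def)
  have e_1: "e 1 = ?f"
    by (simp add: e_def k_def pCons_one)
  have c: "of_nat n * (c x * y) = c (of_nat n * x) * y" for n x y
    by (simp add: c_def of_nat_mult_complex_to_H1_fps[symmetric] mult.assoc)
  have c_1: "c 1 = 1"
    by (simp add: c_def complex_to_H1_fps_const one_H1)
  have p_0: "p 0 = 1"
    by (simp add: p_def c_1 harm_fps_power_def)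
  have rec: "p (Suc n) = (\<Sum>j\<le>n. p j * e (Suc n - j))" for n
  proof (rule exp_recursion[where D = "\<lambda>x. harm_fps x ?f"])
    show "harm_fps (x * e (Suc j)) ?f = x * e (Suc j) * e 1 + harm_fps x ?f * e (Suc j)
        + x * (of_nat (Suc (Suc j)) * e (Suc (Suc j)))" for x j
    proof -
      have "k (Suc j) * F ^ Suc j * F = of_nat (Suc (Suc j)) * (k (Suc (Suc j)) * F ^ Suc (Suc j))"
        unfolding k_Suc[of "Suc j"] power_Suc2 by (simp only: mult.assoc)
      then have "of_nat (Suc (Suc j)) * e (Suc (Suc j)) = H1poly_fps (k (Suc j) * F ^ Suc j * F)"
        unfolding e_Suc H1poly_fps_of_nat_mult[symmetric] by (rule arg_cong[OF sym])
      then show ?thesis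
        unfolding e_1 by (simp only: e_Suc harm_fps_mult_H1poly_fps)
    qed
    show "harm_fps (p n) ?f = of_nat (Suc n) * p (Suc n)" for n
      unfolding p_def c harm_fps_power_Suc
      by (simp add: c_def harm_fps_const_left del: of_nat_Suc)
    \<comment> \<open>The factor \<open>Suc n\<close> is undone by multiplying with its reciprocal
      as an embedded complex scalar.\<close>
    show "x = y" if "of_nat (Suc n) * x = of_nat (Suc n) * y" for n and x y :: "H1 fps"
    proof -
      let ?r = "1 / of_nat (Suc n) :: complex"
      have "c ?r * of_nat (Suc n) = of_nat (Suc n) * (c ?r * 1)"
        by (simp only: mult_1_right mult_of_nat_commute[of _ "c ?r"])
      also have "\<dots> = 1"
        unfolding c by (simp add: c_1 del: of_nat_Suc)
      finally have "c ?r * (of_nat (Suc n) * z) = z" for z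
        by (simp add: mult.assoc[symmetric] del: of_nat_Suc)
      with that show ?thesis by metis
    qed
  qed (use e_1 in \<open>simp_all add: harm_fps_sum_left harm_fps_1_left p_0\<close>)
  have f: "fps_nth ?f 0 = 0" by (simp add: F)
  have p_nth: "fps_nth (p n) N = 0" if "N < n" for n N
    using that f by (simp add: p_def c_def complex_to_H1_fps_const harm_fps_power_nth_eq_0)
  have "Abs_fps (\<lambda>N. \<Sum>n\<le>N. fps_nth (p n) N) =
      1 + Abs_fps (\<lambda>N. \<Sum>n\<le>N. fps_nth (p n) N) * Abs_fps (\<lambda>N. \<Sum>n\<le>N. fps_nth (e n) N)"
  proof (rule sum_fps_recursion[OF p_nth])
    show "fps_nth (e n) N = 0" if "N < n" for n N
      using that F by (simp add: e_def k_def fps_power_nth_eq_0)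
    show "p n = (if n = 0 then 1 else 0) + (\<Sum>i\<le>n. p i * e (n - i))" for n
      using p_0 by (cases n) (simp_all add: rec e_0)
  qed
  moreover have "Abs_fps (\<lambda>N. \<Sum>n\<le>N. fps_nth (e n) N) = H1poly_fps E"
  proof (rule fps_ext)
    fix N
    have "(\<Sum>n\<le>N. fps_nth (e n) N) = (\<Sum>n=1..N. fps_nth (e n) N)"
      by (rule sum.mono_neutral_right) (auto simp: e_def)
    also have "\<dots> = (\<Sum>n=1..N. H1poly (smult (1 / fact n) (fps_nth (F ^ n) N)))"
      by (intro sum.cong refl) (simp add: e_def k_def)
    finally show "fps_nth (Abs_fps (\<lambda>N. \<Sum>n\<le>N. fps_nth (e n) N)) N = fps_nth (H1poly_fps E) N"
      by (simp add: E_def H1poly_sum)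
  qed
  moreover have "Abs_fps (\<lambda>N. \<Sum>n\<le>N. fps_nth (p n) N) = exp_harm ?f"
  proof (rule fps_ext)
    fix N
    have "exp_harm ?f = p 0 + (\<Sum>\<^sub>\<infinity>n\<in>{1..}. p n)"
      unfolding exp_harm_def p_0 by (simp add: p_def c_def)
    moreover have "fps_nth (\<Sum>\<^sub>\<infinity>n\<in>{1..}. p n) N = (\<Sum>n=1..N. fps_nth (p n) N)"
      by (rule infsum_fps_nth) (rule p_nth)
    moreover have "(\<Sum>n\<le>N. fps_nth (p n) N) = fps_nth (p 0) N + (\<Sum>n=1..N. fps_nth (p n) N)"
      unfolding atMost_atLeast0 by (subst sum.atLeast_Suc_atMost) auto
    ultimately show "fps_nth (Abs_fps (\<lambda>N. \<Sum>n\<le>N. fps_nth (p n) N)) N = fps_nth (exp_harm ?f) N"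
      by simp
  qed
  ultimately have "exp_harm ?f = 1 + exp_harm ?f * H1poly_fps E" by simp
  moreover have E_0: "fps_nth (H1poly_fps E) 0 = 0"
    by (simp add: E_def)
  ultimately show ?thesis
    by (intro fps_right_fixpoint_unique[OF _ inv_one_plus_fixpoint[OF E_0] E_0])
qed

subsection \<open>Exponentials of formal power series\<close>

text \<open>The coefficient at \<open>m\<close> of the equation expresses \<open>Suc m\<close> times
  the next coefficient by earlier ones, and \<open>Suc m\<close> is invertible in characteristic
  zero.\<close>

lemma fps_linear_ode_unique:
  fixes A B C :: "'a :: field_char_0 fps"
  assumes "fps_deriv A = C * A" "fps_deriv B = C * B" "fps_nth A 0 = fps_nth B 0"
  shows "A = B"
proof (rule fps_ext)
  fix n
  show "fps_nth A n = fps_nth B n"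
  proof (induction n rule: less_induct)
    case (less n)
    show ?case
    proof (cases n)
      case (Suc m)
      have "of_nat (Suc m) * fps_nth A (Suc m) = of_nat (Suc m) * fps_nth B (Suc m)"
        using arg_cong[OF assms(1), of "\<lambda>f. fps_nth f m"]
          arg_cong[OF assms(2), of "\<lambda>f. fps_nth f m"] less Suc
        by (simp add: fps_mult_nth del: of_nat_Suc)
      then show ?thesis using Suc by (simp del: of_nat_Suc)
    qed (use assms in simp)
  qed
qed

lemma fps_deriv_exp_compose:
  fixes a :: "'a :: field_char_0 fps"
  assumes "fps_nth a 0 = 0"
  shows "fps_deriv (fps_exp 1 oo a) = fps_deriv a * (fps_exp 1 oo a)"
  using assms by (simp add: fps_compose_deriv mult.commute)

text \<open>Exponentials are identified by their differential equation, both for the addition rule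
  and for the logarithmic series.\<close>

lemma fps_exp_compose_eqI:
  fixes a :: "'a :: field_char_0 fps"
  assumes "fps_nth a 0 = 0" "fps_deriv A = fps_deriv a * A" "fps_nth A 0 = 1"
  shows "fps_exp 1 oo a = A"
  by (rule fps_linear_ode_unique[OF fps_deriv_exp_compose[OF assms(1)] assms(2)])
    (simp add: assms(3))

lemma fps_exp_compose_add:
  fixes a b :: "'a :: field_char_0 fps"
  assumes "fps_nth a 0 = 0" "fps_nth b 0 = 0"
  shows "fps_exp 1 oo (a + b) = (fps_exp 1 oo a) * (fps_exp 1 oo b)"
  using assms by (intro fps_exp_compose_eqI) (simp_all add: fps_deriv_exp_compose algebra_simps)

lemma fps_exp_compose_sum:
  fixes a :: "'i \<Rightarrow> 'a :: field_char_0 fps"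
  assumes "\<And>i. i \<in> I \<Longrightarrow> fps_nth (a i) 0 = 0"
  shows "fps_exp 1 oo (\<Sum>i\<in>I. a i) = (\<Prod>i\<in>I. fps_exp 1 oo a i)"
  using assms
  by (induction I rule: infinite_finite_induct)
    (auto simp: fps_exp_compose_add fps_sum_nth sum.neutral)

section \<open>Stirling numbers and the logarithmic series\<close>

lemma fps_exp_minus_1_power_nth:
  "fps_nth ((fps_exp 1 - 1 :: 'a :: field_char_0 fps) ^ j) k = fact j * of_nat (Stirling k j) / fact k"
proof (induction k arbitrary: j)
  case 0
  show ?case by (cases j) (simp_all add: fps_power_zeroth)
next
  case (Suc k)
  show ?case
  proof (cases j)
    case 0
    then show ?thesis by simp
  next
    case [simp]: (Suc i)
    let ?E = "fps_exp 1 - 1 :: 'a fps"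
    \<comment> \<open>The derivative of \<open>?E\<close> is \<open>?E + 1\<close>; comparing
      coefficients gives the recurrence of the Stirling numbers.\<close>
    have "fps_deriv (?E ^ j) = of_nat j * (?E ^ j + ?E ^ i)"
      by (simp only: Suc fps_deriv_power') (simp add: algebra_simps)
    then have "fps_nth (fps_deriv (?E ^ j)) k = of_nat j * (fps_nth (?E ^ j) k + fps_nth (?E ^ i) k)"
      by (simp add: fps_of_nat[symmetric] del: of_nat_Suc)
    then have "of_nat (Suc k) * fps_nth (?E ^ j) (Suc k) =
        of_nat j * (fact j * of_nat (Stirling k j) / fact k + fact i * of_nat (Stirling k i) / fact k)"
      by (simp only: Suc.IH fps_deriv_nth Suc_eq_plus1)
    also have "\<dots> = of_nat (Suc k) * (fact j * of_nat (Stirling (Suc k) j) / fact (Suc k))"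
      by (simp add: field_simps del: of_nat_Suc) (simp add: algebra_simps)
    finally show ?thesis by (metis mult_left_cancel of_nat_neq_0)
  qed
qed

definition phi_poly :: "nat \<Rightarrow> complex poly" where
  "phi_poly k = (\<Sum>j=1..k. monom (of_nat (fact (j - 1) * Stirling k j)) j)"

definition phi_egf :: "complex \<Rightarrow> complex fps" where
  "phi_egf s = Abs_fps (\<lambda>k. poly (phi_poly k) s / fact k)"

text \<open>The outer series is - log (1 - s X). Its denominator \<open>j\<close> turns the factor
  \<open>fact j\<close> of the powers of \<open>fps_exp 1 - 1\<close> into
  \<open>fact (j - 1)\<close>.\<close>

lemma phi_egf_conv_compose:
  "phi_egf s = Abs_fps (\<lambda>j. s ^ j / of_nat j) oo (fps_exp 1 - 1)"
proof (rule fps_ext)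
  fix k
  have "fps_nth (Abs_fps (\<lambda>j. s ^ j / of_nat j) oo (fps_exp 1 - 1)) k =
      (\<Sum>j=0..k. s ^ j / of_nat j * (fact j * of_nat (Stirling k j) / fact k))"
    by (simp add: fps_compose_nth fps_exp_minus_1_power_nth)
  \<comment> \<open>The term at \<open>j = 0\<close> is zero, since division by zero yields
    0.\<close>
  also have "\<dots> = (\<Sum>j=1..k. s ^ j / of_nat j * (fact j * of_nat (Stirling k j) / fact k))"
    by (rule sum.mono_neutral_right) auto
  also have "\<dots> = (\<Sum>j=1..k. of_nat (fact (j - 1) * Stirling k j) * s ^ j / fact k)"
    by (intro sum.cong) (auto simp: fact_reduce field_simps)
  also have "\<dots> = fps_nth (phi_egf s) k"
    by (simp add: phi_egf_def phi_poly_def poly_sum poly_monom sum_divide_distrib)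
  finally show "fps_nth (phi_egf s) k =
      fps_nth (Abs_fps (\<lambda>j. s ^ j / of_nat j) oo (fps_exp 1 - 1)) k" ..
qed

lemma phi_egf_0 [simp]: "fps_nth (phi_egf s) 0 = 0"
  by (simp add: phi_egf_def phi_poly_def)

text \<open>The derivative of - log (1 - s X) is a geometric series, so
  \<open>1 - fps_const s * fps_X\<close> satisfies the required differential equation; then
  \<open>fps_exp 1 - 1\<close> is substituted for X.\<close>

lemma exp_compose_uminus_phi_egf:
  "fps_exp 1 oo (- phi_egf s) = 1 - fps_const s * (fps_exp 1 - 1)"
proof -
  let ?l = "Abs_fps (\<lambda>j. s ^ j / of_nat j) :: complex fps"
  have "fps_exp 1 oo (- ?l) = 1 - fps_const s * fps_X"
  proof (rule fps_exp_compose_eqI)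
    have "fps_deriv ?l = Abs_fps (\<lambda>n. s ^ Suc n)"
      by (simp add: fps_eq_iff del: of_nat_Suc)
    then have "fps_deriv ?l * (1 - fps_const s * fps_X) = fps_const s"
      by (simp add: fps_eq_iff algebra_simps)
    then show "fps_deriv (1 - fps_const s * fps_X) = fps_deriv (- ?l) * (1 - fps_const s * fps_X)"
      by simp
  qed simp_all
  then have "(fps_exp 1 oo (- ?l)) oo (fps_exp 1 - 1) = 1 - fps_const s * (fps_exp 1 - 1)"
    by (simp add: fps_compose_sub_distrib fps_compose_mult_distrib)
  then show ?thesis
    by (simp add: fps_compose_assoc[symmetric] fps_compose_uminus phi_egf_conv_compose)
qed

definition log_series :: "complex \<Rightarrow> complex fps" where
  "log_series s = (- phi_egf s oo (fps_const \<i> * fps_X)) + (- phi_egf s oo (fps_const (- \<i>) * fps_X))"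

text \<open>The n-th powers of \<i> and -\<i> cancel for odd n and double for even n. This accounts
  for the even indices of \<open>phi\<close> and the factor 2 in the exponent.\<close>

lemma log_series_nth:
  "fps_nth (log_series s) n =
     (if even n then - 2 * (- 1) ^ (n div 2) * (poly (phi_poly n) s / fact n) else 0)"
  by (auto simp: log_series_def phi_egf_def power_minus_odd elim!: evenE oddE)

lemma log_series_0 [simp]: "fps_nth (log_series s) 0 = 0"
  by (simp add: log_series_def)

text \<open>Euler's formula makes the two factors a sum and a difference with the same terms. Their
  product is a difference of squares, and eliminating the squared sine leaves a polynomial identity
  in the cosine.\<close>

lemma exp_compose_log_series:
  "fps_exp 1 oo log_series s = 1 + fps_const (s + s ^ 2) * (2 - 2 * fps_cos 1)"
proof -
  have "fps_exp 1 oo (- phi_egf s oo (fps_const c * fps_X)) = 1 - fps_const s * (fps_exp c - 1)" for c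
    by (subst fps_compose_assoc)
      (simp_all add: exp_compose_uminus_phi_egf fps_compose_sub_distrib fps_compose_mult_distrib)
  then have "fps_exp 1 oo log_series s =
      (1 - fps_const s * (fps_exp \<i> - 1)) * (1 - fps_const s * (fps_exp (- \<i>) - 1))"
    unfolding log_series_def by (subst fps_exp_compose_add) simp_all
  also have "fps_exp \<i> = fps_cos 1 + fps_const \<i> * fps_sin 1"
    using fps_exp_ii_sin_cos[of 1] by simp
  also have "fps_exp (- \<i>) = fps_cos 1 - fps_const \<i> * fps_sin 1"
    using fps_exp_minus_ii_sin_cos[of 1] by simp
  also have "(1 - fps_const s * (fps_cos 1 + fps_const \<i> * fps_sin 1 - 1)) *
      (1 - fps_const s * (fps_cos 1 - fps_const \<i> * fps_sin 1 - 1)) =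
      (1 - fps_const s * (fps_cos 1 - 1)) ^ 2 - fps_const s ^ 2 * fps_const \<i> ^ 2 * fps_sin 1 ^ 2"
    by (simp add: algebra_simps power2_eq_square)
  also have "fps_const \<i> ^ 2 = - (1 :: complex fps)"
    by (simp add: fps_const_power flip: fps_const_neg)
  also have "fps_sin 1 ^ 2 = 1 - (fps_cos 1 ^ 2 :: complex fps)"
    using fps_sin_cos_sum_of_squares[of "1 :: complex"] by (simp add: algebra_simps)
  also have "(1 - fps_const s * (fps_cos 1 - 1)) ^ 2 - fps_const s ^ 2 * - 1 * (1 - fps_cos 1 ^ 2) =
      1 + (fps_const s + fps_const s ^ 2) * (2 - 2 * fps_cos 1)"
  proof -
    have "(1 - a * (c - 1)) ^ 2 - a ^ 2 * - 1 * (1 - c ^ 2) = 1 + (a + a ^ 2) * (2 - 2 * c)"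
      for a c :: "complex fps" by (simp add: algebra_simps power2_eq_square)
    then show ?thesis .
  qed
  also have "fps_const s + fps_const s ^ 2 = fps_const (s + s ^ 2)"
    by (simp add: fps_const_power)
  finally show ?thesis .
qed

section \<open>The arcsine series\<close>

lemma Arcsin_has_fps_expansion: "Arcsin has_fps_expansion arcsin_fps"
  unfolding arcsin_fps_def
proof (rule has_fps_expansion_fps_expansion)
  show "Arcsin holomorphic_on ball 0 1"
    by (rule holomorphic_on_Arcsin) (auto intro: le_less_trans[OF abs_Re_le_cmod])
qed auto

lemma arcsin_fps_0 [simp]: "fps_nth arcsin_fps 0 = 0"
  by (simp add: arcsin_fps_def fps_expansion_def)

lemma two_arcsin_half_0 [simp]: "fps_nth (two_arcsin_half c) 0 = 0"
  by (simp add: two_arcsin_half_def)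

text \<open>By the double angle formula 2 - 2 cos (2 t) is 4 times the square of sin t, with t =
  Arcsin (c z / 2). The formal identity follows from uniqueness of expansions of analytic
  functions.\<close>

lemma cos_compose_two_arcsin_half:
  "(2 - 2 * fps_cos 1) oo two_arcsin_half c = fps_const (c ^ 2) * fps_X ^ 2"
proof (rule fps_expansion_unique_complex)
  let ?f = "(\<lambda>z. 2 - 2 * cos (1 * z)) \<circ> (\<lambda>z. 2 * (Arcsin \<circ> (\<lambda>z. c / 2 * z)) z)"
  show "?f has_fps_expansion ((2 - 2 * fps_cos 1) oo two_arcsin_half c)"
    unfolding two_arcsin_half_def
    by (intro fps_expansion_intros Arcsin_has_fps_expansion) simp_all
  have "?f = (\<lambda>z. c ^ 2 * z ^ 2)"
    by (auto simp: fun_eq_iff cos_double_sin power2_eq_square)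
  then show "?f has_fps_expansion fps_const (c ^ 2) * fps_X ^ 2"
    by (auto intro!: fps_expansion_intros)
qed

text \<open>Two polynomials of degree at most \<open>L\<close> that agree at \<open>L + 1\<close>
  points are equal.\<close>

lemma prod_roots_of_unity:
  assumes "L \<ge> 1"
  shows "(\<Prod>m=1..L. [:1, - exp (2 * of_real pi * \<i> * of_nat m / of_nat L):]) = 1 - monom (1::complex) L"
    (is "?P = ?Q")
proof (rule poly_eqI_degree)
  \<comment> \<open>The roots of unity supply only \<open>L\<close> points; 0, where both sides are
    1, is the remaining one.\<close>
  let ?A = "insert 0 {z :: complex. z ^ L = 1}"
  show "poly ?P z = poly ?Q z" if "z \<in> ?A" for z
  proof (cases "z = 0")
    case True
    then show ?thesis using assms by (simp add: poly_prod poly_monom)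
  next
    case False
    with that have z: "z ^ L = 1" by simp
    then have "inverse z \<in> {z. z ^ L = 1}" by (simp add: power_inverse)
    then obtain j where j: "j < L" "inverse z = exp (2 * of_real pi * \<i> * of_nat j / of_nat L)"
      unfolding complex_roots_unity[OF assms] by auto
    \<comment> \<open>The root 1 has index 0 in \<open>complex_roots_unity\<close> but index
      \<open>L\<close> in the product, which starts at 1.\<close>
    define m where "m = (if j = 0 then L else j)"
    have "inverse z = exp (2 * of_real pi * \<i> * of_nat m / of_nat L)" "m \<in> {1..L}"
      using j assms by (auto simp: m_def)
    then have "poly ?P z = 0"
      using False by (auto simp: poly_prod intro!: bexI[of _ m]) (metis right_inverse)
    with z show ?thesis by (simp add: poly_monom)
  qed
  have "finite {z :: complex. z ^ L = 1}"
    using assms by (intro finite_roots_unity) auto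
  moreover have "(0 :: complex) \<notin> {z. z ^ L = 1}" using assms by (simp add: power_0_left)
  ultimately have card: "card ?A = Suc L"
    using assms by (simp add: card_complex_roots_unity)
  have "degree ?P \<le> sum (degree \<circ> (\<lambda>m. [:1, - exp (2 * of_real pi * \<i> * of_nat m / of_nat L):])) {1..L}"
    by (rule degree_prod_sum_le) simp
  then show "degree ?P < card ?A" by (simp add: card)
  show "degree ?Q < card ?A"
    unfolding card less_Suc_eq_le by (intro degree_diff_le degree_monom_le) simp
qed

lemma exp_compose_sum_log_series:
  "fps_exp 1 oo (\<Sum>m\<in>I. log_series s oo two_arcsin_half (c m)) =
    (\<Prod>m\<in>I. 1 + fps_const ((s + s ^ 2) * c m ^ 2) * fps_X ^ 2)"
proof -
  have "fps_exp 1 oo (log_series s oo two_arcsin_half (c m)) =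
      1 + fps_const ((s + s ^ 2) * c m ^ 2) * fps_X ^ 2" for m
    by (subst fps_compose_assoc)
      (simp_all only: exp_compose_log_series fps_compose_add_distrib fps_compose_mult_distrib
        two_arcsin_half_0 fps_const_compose fps_compose_1 log_series_0 cos_compose_two_arcsin_half
        mult.assoc[symmetric] fps_const_mult)
  then show ?thesis
    by (subst fps_exp_compose_sum) simp_all
qed

text \<open>Substitute - a X^2 for X in \<open>prod_roots_of_unity\<close>; the squares of
  \<open>exp (of_nat m * of_real pi * \<i> / of_nat L)\<close> are the roots of unity there.\<close>

lemma prod_one_plus_roots_of_unity:
  assumes "L \<ge> 1"
  shows "(\<Prod>m=1..L. 1 + fps_const (a * exp (of_nat m * of_real pi * \<i> / of_nat L) ^ 2) * fps_X ^ 2)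
    = 1 - fps_const ((- a) ^ L) * (fps_X ^ (2 * L) :: complex fps)"
proof -
  let ?b = "fps_const (- a) * fps_X ^ 2 :: complex fps"
  let ?w = "\<lambda>m. exp (2 * of_real pi * \<i> * of_nat m / of_nat L)"
  have "1 + fps_const (a * exp (of_nat m * of_real pi * \<i> / of_nat L) ^ 2) * fps_X ^ 2 =
      fps_of_poly [:1, - ?w m:] oo ?b" for m
  proof -
    have "fps_of_poly [:1, - ?w m:] = 1 + fps_const (- ?w m) * fps_X"
      by (simp add: fps_of_poly_pCons)
    then have "fps_of_poly [:1, - ?w m:] oo ?b = 1 + fps_const (- ?w m) * ?b"
      by (simp only: fps_compose_add_distrib) (simp add: fps_compose_mult_distrib)
    also have "fps_const (- ?w m) * ?b = fps_const (- ?w m * - a) * fps_X ^ 2"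
      by (simp only: mult.assoc[symmetric] fps_const_mult)
    also have "- ?w m * - a = a * exp (of_nat m * of_real pi * \<i> / of_nat L) ^ 2"
      by (simp add: exp_double[symmetric] algebra_simps)
    finally show ?thesis ..
  qed
  then have "(\<Prod>m=1..L. 1 + fps_const (a * exp (of_nat m * of_real pi * \<i> / of_nat L) ^ 2) * fps_X ^ 2)
      = fps_of_poly (\<Prod>m=1..L. [:1, - ?w m:]) oo ?b"
    by (simp add: fps_of_poly_prod fps_compose_prod_distrib)
  also have "\<dots> = 1 - ?b ^ L"
    unfolding prod_roots_of_unity[OF assms]
    by (simp add: fps_of_poly_diff fps_of_poly_monom' fps_compose_sub_distrib fps_X_power_compose)
  also have "?b ^ L = fps_const ((- a) ^ L) * fps_X ^ (2 * L)"
    by (simp only: power_mult_distrib fps_const_power power_mult)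
  finally show ?thesis .
qed

subsection \<open>Transfer to the harmonic algebra\<close>

lemma hbar_pow_mult: "hbar_pow m * hbar_pow n = hbar_pow (m + n)"
  by (simp add: hbar_pow_def mult_single)

lemma hbar_pow_0 [simp]: "hbar_pow 0 = 1"
  by (simp add: hbar_pow_def)

lemma hbar_pow_power: "hbar_pow m ^ n = hbar_pow (int n * m)"
  by (induction n) (simp_all add: hbar_pow_mult algebra_simps)

lemma zpoly_sum: "zpoly (sum f A) = (\<Sum>a\<in>A. zpoly (f a))"
  by (induction A rule: infinite_finite_induct) (simp_all add: zpoly_add)

lemma zpoly_phi_poly: "zpoly (phi_poly k) = cmul (hbar_pow (- int k)) (phi k)"
proof -
  have *: "zpoly (monom (of_nat a) j) = cmul (hbar_pow (- int k)) (cmul (of_nat a * hbar_pow (int k - int j)) (gen_g j))"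
    if "j \<in> {1..k}" for a j
  proof -
    from that obtain i where "j = Suc i" by (cases j) auto
    moreover have "of_nat a * hbar_pow m = Poly_Mapping.single m (of_nat a)" for m
      by (simp add: hbar_pow_def mult_single flip: single_of_nat)
    ultimately show ?thesis
      by (simp add: gen_g_def zpoly_monom_Suc cmul_single) (simp add: hbar_pow_def mult_single)
  qed
  show ?thesis
    unfolding phi_poly_def phi_def zpoly_sum cmul_sum by (intro sum.cong refl *)
qed

lemma gen_e_2: "gen_e 2 = cmul (hbar_pow 2) (zpoly [:0, 1, 1:])"
proof -
  have "[:0, 1, 1:] = monom (1 :: complex) 1 + monom 1 2"
    by (simp add: monom_altdef numeral_2_eq_2)
  then show ?thesis
    by (simp add: zpoly_add numeral_2_eq_2 zpoly_monom_Suc gen_e_def gen_g_def cmul_add_right cmul_single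
        hbar_pow_def mult_single add.commute)
qed

lemma circ_power_cmul_zpoly:
  assumes "L \<ge> 1"
  shows "circ_power (cmul c (zpoly p)) L = cmul (c ^ L) (zpoly (p ^ L))"
proof -
  have "((\<lambda>v. circ v (cmul c (zpoly p))) ^^ n) (cmul c (zpoly p)) = cmul (c ^ Suc n) (zpoly (p ^ Suc n))" for n
    by (induction n) (simp_all add: circ_simps cmul_cmul zpoly_mult[symmetric] mult_ac)
  from this[of "L - 1"] show ?thesis
    using assms by (simp add: circ_power_def del: power_Suc)
qed

text \<open>The power of \<open>\<hbar>\<close> that \<open>gen_e_2\<close> contributes
  \<open>L\<close> times cancels the given prefactor, leaving the sign.\<close>

lemma H1poly_circ_power_gen_e_2:
  assumes "L \<ge> 1"
  shows "z_to_H1 (cmul ((- 1) ^ L * hbar_pow (- 2 * int L)) (circ_power (gen_e 2) L)) =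
    H1poly ((- [:0, 1, 1:]) ^ L)"
proof -
  have "(- 1) ^ L * hbar_pow (- 2 * int L) * hbar_pow 2 ^ L = Poly_Mapping.single 0 ((- 1) ^ L)"
    by (cases "even L") (simp_all add: hbar_pow_power mult.assoc hbar_pow_mult single_uminus)
  then have "cmul ((- 1) ^ L * hbar_pow (- 2 * int L)) (circ_power (gen_e 2) L) =
      zpoly (smult ((- 1) ^ L) ([:0, 1, 1:] ^ L))"
    by (simp only: gen_e_2 circ_power_cmul_zpoly[OF assms] cmul_cmul zpoly_smult)
  also have "smult ((- 1) ^ L) ([:0, 1, 1:] ^ L) = (- [:0, 1, 1:] :: complex poly) ^ L"
    by (simp only: smult_power[symmetric]) simp
  finally show ?thesis by (simp only: H1poly_def)
qed

text \<open>The exponent of the theorem with polynomial coefficients. Stopping at \<open>N\<close>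
  loses nothing if \<open>S k\<close> has order at least \<open>k\<close>.\<close>

definition exponent_poly_fps :: "(nat \<Rightarrow> complex fps) \<Rightarrow> complex poly fps" where
  "exponent_poly_fps S =
     Abs_fps (\<lambda>N. \<Sum>k=1..N. smult (2 * (- 1) ^ (k - 1) / fact (2 * k) * fps_nth (S k) N) (phi_poly (2 * k)))"

lemma H1poly_exponent_poly_fps:
  assumes "\<And>k N. N < k \<Longrightarrow> fps_nth (S k) N = 0"
  shows "2 * (\<Sum>\<^sub>\<infinity>k\<in>{1..}.
      complex_to_H1_fps (fps_const ((-1) ^ (k - 1) / fact (2 * k)))
      * fps_const (z_to_H1 (cmul (hbar_pow (- 2 * int k)) (phi (2 * k))))
      * complex_to_H1_fps (S k)) = H1poly_fps (exponent_poly_fps S)"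
proof (rule fps_ext)
  fix N
  let ?t = "\<lambda>k. complex_to_H1_fps (fps_const ((-1) ^ (k - 1) / fact (2 * k)))
      * fps_const (z_to_H1 (cmul (hbar_pow (- 2 * int k)) (phi (2 * k)))) * complex_to_H1_fps (S k)"
  have t: "fps_nth (?t k) N =
      H1poly (smult ((- 1) ^ (k - 1) / fact (2 * k) * fps_nth (S k) N) (phi_poly (2 * k)))" for k N
  proof -
    have "z_to_H1 (cmul (hbar_pow (- 2 * int k)) (phi (2 * k))) = H1poly (phi_poly (2 * k))"
      by (simp add: H1poly_def zpoly_phi_poly)
    then have "fps_nth (?t k) N = Poly_Mapping.single [] (Poly_Mapping.single 0 ((- 1) ^ (k - 1) / fact (2 * k)))
        * (H1poly (phi_poly (2 * k)) * Poly_Mapping.single [] (Poly_Mapping.single 0 (fps_nth (S k) N)))"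
      unfolding complex_to_H1_fps_const by (simp add: complex_to_H1_fps_def mult.assoc)
    also have "\<dots> = Poly_Mapping.single [] (Poly_Mapping.single 0 ((- 1) ^ (k - 1) / fact (2 * k))) *
        Poly_Mapping.single [] (Poly_Mapping.single 0 (fps_nth (S k) N)) * H1poly (phi_poly (2 * k))"
      by (simp only: single_Nil_commute[of _ "H1poly (phi_poly (2 * k))"] mult.assoc)
    finally show ?thesis by (simp add: H1poly_smult mult_single plus_list_def)
  qed
  have "fps_nth (\<Sum>\<^sub>\<infinity>k\<in>{1..}. ?t k) N = (\<Sum>k=1..N. fps_nth (?t k) N)"
    by (rule infsum_fps_nth) (simp only: t assms mult_zero_right smult_0_left H1poly_0)
  then have "fps_nth (2 * (\<Sum>\<^sub>\<infinity>k\<in>{1..}. ?t k)) N =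
      (\<Sum>k=1..N. fps_nth (?t k) N + fps_nth (?t k) N)"
    by (simp only: mult_2[of "infsum _ _"] fps_add_nth sum.distrib)
  also have "\<dots> = (\<Sum>k=1..N. H1poly (smult (2 * (- 1) ^ (k - 1) / fact (2 * k) * fps_nth (S k) N)
      (phi_poly (2 * k))))"
    unfolding t H1poly_add[symmetric] smult_add_left[symmetric] by (simp add: mult_ac)
  also have "\<dots> = fps_nth (H1poly_fps (exponent_poly_fps S)) N"
    by (simp add: exponent_poly_fps_def H1poly_sum)
  finally show "fps_nth (2 * (\<Sum>\<^sub>\<infinity>k\<in>{1..}. ?t k)) N = fps_nth (H1poly_fps (exponent_poly_fps S)) N" .
qed

section \<open>Evaluation at a complex value of s\<close>

lemma poly_fps_power_nth:
  fixes F :: "'a :: comm_ring_1 poly fps"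
  shows "poly (fps_nth (F ^ n) N) s = fps_nth (Abs_fps (\<lambda>N. poly (fps_nth F N) s) ^ n) N"
  by (induction n arbitrary: N) (simp_all add: fps_mult_nth poly_sum)

lemma poly_exponent_poly_fps:
  "Abs_fps (\<lambda>N. poly (fps_nth (exponent_poly_fps (\<lambda>k. \<Sum>m\<in>I. two_arcsin_half (c m) ^ (2 * k))) N) s)
    = (\<Sum>m\<in>I. log_series s oo two_arcsin_half (c m))"
proof (rule fps_ext)
  fix N
  have "fps_nth (log_series s oo two_arcsin_half (c m)) N =
      (\<Sum>k=1..N. 2 * (- 1) ^ (k - 1) / fact (2 * k) * poly (phi_poly (2 * k)) s
        * fps_nth (two_arcsin_half (c m) ^ (2 * k)) N)" for m
  proof -
    let ?g = "\<lambda>i. fps_nth (log_series s) i * fps_nth (two_arcsin_half (c m) ^ i) N"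
    have "fps_nth (log_series s oo two_arcsin_half (c m)) N = sum ?g {0..N}"
      by (simp add: fps_compose_nth)
    \<comment> \<open>Only positive even indices contribute. Those beyond \<open>N\<close> are
      harmless, since the powers of \<open>two_arcsin_half (c m)\<close> then have too large an
      order.\<close>
    also have "\<dots> = sum ?g ((*) 2 ` {1..N})"
    proof (rule sum.mono_neutral_cong)
      show "?g i = 0" if "i \<in> {0..N} - (*) 2 ` {1..N}" for i
      proof (cases "even i \<and> i \<noteq> 0")
        case True
        then obtain j where "i = 2 * j" "j \<noteq> 0" by auto
        with that show ?thesis by force
      qed (auto simp: log_series_nth phi_poly_def)
      show "?g i = 0" if "i \<in> (*) 2 ` {1..N} - {0..N}" for i
        using that by (subst fps_power_nth_eq_0) auto
    qed auto
    also have "\<dots> = (\<Sum>k=1..N. ?g (2 * k))"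
      by (subst sum.reindex) (auto simp: inj_on_def)
    also have "\<dots> = (\<Sum>k=1..N. 2 * (- 1) ^ (k - 1) / fact (2 * k) * poly (phi_poly (2 * k)) s
        * fps_nth (two_arcsin_half (c m) ^ (2 * k)) N)"
    proof (rule sum.cong[OF refl])
      fix k assume "k \<in> {1..N}"
      \<comment> \<open>As \<open>k\<close> is positive, this sign matches
        \<open>log_series_nth\<close> with the exponent \<open>k - 1\<close> of the theorem.\<close>
      then have "(- 1) ^ k = - ((- 1) ^ (k - 1) :: complex)"
        by (cases k) auto
      then show "?g (2 * k) = 2 * (- 1) ^ (k - 1) / fact (2 * k) * poly (phi_poly (2 * k)) s
          * fps_nth (two_arcsin_half (c m) ^ (2 * k)) N"
        by (simp add: log_series_nth)
    qed
    finally show ?thesis .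
  qed
  then show "fps_nth (Abs_fps (\<lambda>N. poly (fps_nth (exponent_poly_fps
      (\<lambda>k. \<Sum>m\<in>I. two_arcsin_half (c m) ^ (2 * k))) N) s)) N =
      fps_nth (\<Sum>m\<in>I. log_series s oo two_arcsin_half (c m)) N"
    by (simp add: exponent_poly_fps_def poly_sum fps_sum_nth sum_distrib_left sum_distrib_right)
      (subst sum.swap, simp add: mult_ac)
qed

text \<open>Kept general in \<open>I\<close> and \<open>c\<close> to serve both identities of the
  theorem. It suffices to compute the exponential of the exponent with polynomial
  coefficients.\<close>

lemma inv_one_plus_eq_exp_harm:
  assumes "L \<ge> 1"
    and prod: "\<And>s. (\<Prod>m\<in>I. 1 + fps_const ((s + s ^ 2) * c m ^ 2) * fps_X ^ 2) =
      1 - fps_const ((- (s + s ^ 2)) ^ L) * (fps_X ^ (2 * L) :: complex fps)"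
  shows "inv_one_plus
      (fps_const (z_to_H1 (cmul ((-1) ^ L * hbar_pow (- 2 * int L)) (circ_power (gen_e 2) L)))
        * fps_X ^ (2 * L))
    = exp_harm (2 * (\<Sum>\<^sub>\<infinity>k\<in>{1..}.
        complex_to_H1_fps (fps_const ((-1) ^ (k - 1) / fact (2 * k)))
        * fps_const (z_to_H1 (cmul (hbar_pow (- 2 * int k)) (phi (2 * k))))
        * complex_to_H1_fps (\<Sum>m\<in>I. two_arcsin_half (c m) ^ (2 * k))))"
proof -
  let ?S = "\<lambda>k. \<Sum>m\<in>I. two_arcsin_half (c m) ^ (2 * k)"
  let ?F = "exponent_poly_fps ?S"
  let ?q = "- [:0, 1, 1:] :: complex poly"
  define E where "E = Abs_fps (\<lambda>N. \<Sum>j=1..N. smult (1 / fact j) (fps_nth (?F ^ j) N))"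
  have E: "fps_nth E N = (if N = 2 * L then - (?q ^ L) else 0)" for N
  \<comment> \<open>A complex polynomial is determined by its values, so the exponential can be
    computed over a field, one \<open>s\<close> at a time.\<close>
  proof (rule poly_ext)
    fix s
    let ?f = "\<Sum>m\<in>I. log_series s oo two_arcsin_half (c m)"
    have "poly (fps_nth E N) s = (\<Sum>j=1..N. fps_nth (?f ^ j) N / fact j)"
      by (simp add: E_def poly_sum poly_fps_power_nth poly_exponent_poly_fps)
    also have "\<dots> = fps_nth (fps_exp 1 oo ?f) N - fps_nth 1 N"
      by (simp add: fps_compose_nth sum.atLeast_Suc_atMost[of 0 N])
    also have "fps_exp 1 oo ?f = 1 - fps_const ((- (s + s ^ 2)) ^ L) * fps_X ^ (2 * L)"
      unfolding exp_compose_sum_log_series prod ..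
    finally show "poly (fps_nth E N) s = poly (if N = 2 * L then - (?q ^ L) else 0) s"
      by (simp add: poly_power algebra_simps power2_eq_square)
  qed
  have "2 * (\<Sum>\<^sub>\<infinity>k\<in>{1..}.
        complex_to_H1_fps (fps_const ((-1) ^ (k - 1) / fact (2 * k)))
        * fps_const (z_to_H1 (cmul (hbar_pow (- 2 * int k)) (phi (2 * k))))
        * complex_to_H1_fps (?S k)) = H1poly_fps ?F"
    by (rule H1poly_exponent_poly_fps) (simp add: fps_sum_nth fps_power_nth_eq_0)
  moreover have "exp_harm (H1poly_fps ?F) = inv_one_plus (- H1poly_fps E)"
    unfolding E_def by (rule exp_harm_H1poly_fps) (simp add: exponent_poly_fps_def)
  moreover have "- H1poly_fps E = fps_const (H1poly (?q ^ L)) * fps_X ^ (2 * L)"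
    by (simp add: fps_eq_iff E H1poly_uminus)
  ultimately show ?thesis
    by (simp only: H1poly_circ_power_gen_e_2[OF assms(1)])
qed

theorem corollary4p3:
  shows "(\<forall>L::nat. L \<ge> 1 \<longrightarrow>
      inv_one_plus
        (fps_const (z_to_H1 (cmul ((-1) ^ L * hbar_pow (- 2 * int L)) (circ_power (gen_e 2) L)))
          * fps_X ^ (2 * L))
      = exp_harm (2 * (\<Sum>\<^sub>\<infinity>k\<in>{1..}.
          complex_to_H1_fps (fps_const ((-1) ^ (k - 1) / fact (2 * k)))
          * fps_const (z_to_H1 (cmul (hbar_pow (- 2 * int k)) (phi (2 * k))))
          * complex_to_H1_fps
              (\<Sum>m=1..L. two_arcsin_half (exp (of_nat m * of_real pi * \<i> / of_nat L)) ^ (2 * k)))))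
    \<and> inv_one_plus
        (- (fps_const (z_to_H1 (cmul (hbar_pow (- 2)) (gen_e 2))) * fps_X ^ 2))
      = exp_harm (2 * (\<Sum>\<^sub>\<infinity>k\<in>{1..}.
          complex_to_H1_fps (fps_const ((-1) ^ (k - 1) / fact (2 * k)))
          * fps_const (z_to_H1 (cmul (hbar_pow (- 2 * int k)) (phi (2 * k))))
          * complex_to_H1_fps (two_arcsin_half 1 ^ (2 * k))))"
proof (intro conjI allI impI)
  fix L :: nat
  assume "L \<ge> 1"
  then show "inv_one_plus
        (fps_const (z_to_H1 (cmul ((-1) ^ L * hbar_pow (- 2 * int L)) (circ_power (gen_e 2) L)))
          * fps_X ^ (2 * L))
      = exp_harm (2 * (\<Sum>\<^sub>\<infinity>k\<in>{1..}.
          complex_to_H1_fps (fps_const ((-1) ^ (k - 1) / fact (2 * k)))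
          * fps_const (z_to_H1 (cmul (hbar_pow (- 2 * int k)) (phi (2 * k))))
          * complex_to_H1_fps
              (\<Sum>m=1..L. two_arcsin_half (exp (of_nat m * of_real pi * \<i> / of_nat L)) ^ (2 * k))))"
    by (intro inv_one_plus_eq_exp_harm prod_one_plus_roots_of_unity)
next
  have "z_to_H1 (cmul ((-1) ^ 1 * hbar_pow (- 2 * int 1)) (circ_power (gen_e 2) 1)) =
      - z_to_H1 (cmul (hbar_pow (- 2)) (gen_e 2))"
    by (simp add: circ_power_def z_to_H1_simps cmul_eq_mult single_uminus)
  \<comment> \<open>The value \<open>c = 1\<close> replaces e^{\<pi>i} = -1 from the case
    \<open>L = 1\<close>; the product condition sees only its square.\<close>
  moreover have "(\<Prod>m\<in>{1::nat}. 1 + fps_const ((s + s ^ 2) * 1 ^ 2) * fps_X ^ 2) =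
      1 - fps_const ((- (s + s ^ 2)) ^ 1) * (fps_X ^ (2 * 1) :: complex fps)" for s
    by (simp add: fps_eq_iff)
  note inv_one_plus_eq_exp_harm[of 1 "\<lambda>_. 1" "{1::nat}", OF _ this]
  ultimately show "inv_one_plus
        (- (fps_const (z_to_H1 (cmul (hbar_pow (- 2)) (gen_e 2))) * fps_X ^ 2))
      = exp_harm (2 * (\<Sum>\<^sub>\<infinity>k\<in>{1..}.
          complex_to_H1_fps (fps_const ((-1) ^ (k - 1) / fact (2 * k)))
          * fps_const (z_to_H1 (cmul (hbar_pow (- 2 * int k)) (phi (2 * k))))
          * complex_to_H1_fps (two_arcsin_half 1 ^ (2 * k))))"
    by (simp flip: fps_const_neg)
qed

end
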